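(* If $p=\langle H,f,f^-,c\rangle$ is a loopless $p$-dialectical system then $L(x)=\lim_s L_s(x)$ exists for every $x$, and for every $x$, \[ f_x\in A_p \iff c\notin H(L(x)\cup\{f_x\}). \]
   Context: An enumeration operator is a c.e. set $H$ of (codes of) pairs $\langle x,D\rangle$, $x\in\omega$, $D\subseteq\omega$ finite; $H(X)=\{x:\exists D\subseteq X\ \langle x,D\rangle\in H\}$. $H$ is an algebraic closure operator if $X\subseteq H(X)$ and $H(H(X))\subseteq H(X)$ for all $X$. A computable approximation $\alpha=\{H_s\}$ to $H$ is a computable increasing sequence of finite sets of pairs with union $H$. A $p$-dialectical system is $p=\langle H,f,f^-,c\rangle$ with $H$ an enumeration operator that is an algebraic closure operator, $H(\emptyset)\ne\emptyset$, $H(\{c\})=\omega$; $f$ a computable permutation of $\omega$ ($f_i=f(i)$); $f^-$ computable and acyclic (every $f^-$-orbit infinite); $c\in\omega$. $p$-dialectical procedure relative to $\alpha$: stacks $r_s(x)$, $m(s)$, finite sets $A_s$; $\rho_s(x)$ = top of $r_s(x)$ when nonempty, $L_s(x)=\{\rho_s(y):y<x,\ r_s(y)\ne\langle\,\rangle\}$, $\chi_s(i)=H_s(L_s(i+1))$. Stage 0: $m(0)=0$, $r_0(0)=\langle f_0\rangle$, other stacks empty, $A_0=\emptyset$. Stage $s+1$, $m=m(s)$: (1) if no $k\le m$ has $c\in\chi_s(k)$: $m(s+1)=m+1$, stacks at $x\le m$ unchanged, $r_{s+1}(m+1)=\langle f_{m+1}\rangle$, stacks above empty; (2) otherwise with $z$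 least such $k$: $m(s+1)=z$, stacks at $x<z$ unchanged, $r_{s+1}(z)=r_s(z)^\frown\langle f^-(\rho_s(z))\rangle$, stacks at $x>z$ empty. $A_{s+1}=\bigcup_{i<m(s+1)}\chi_{s+1}(i)$. Final theses $A_p=\{f_x:\exists t\,\forall s\ge t\ f_x\in A_s\}$ (independent of $\alpha$). $p$ is loopless if for some computable approximation $\alpha$ to $H$, for every $u$ the set $\{\rho_s(u):s\in\omega\}$ is finite; the limits $L(x)$ are taken with respect to such an approximation. *)

theory Defs
  imports Main "HOL-Library.Nat_Bijection"
begin

section \<open>Computability\<close>

datatype recf =
    Zero
  | Succ
  | Proj nat
  | Comp recf "recf list"
  | PrimRec recf recf
  | Mu recf

text \<open>\<open>evaluates e xs y\<close>: the partial recursive function with description \<open>e\<close> converges on the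
  arguments \<open>xs\<close> with value \<open>y\<close>. In primitive recursion and minimisation, the recursion (search)
  variable is the first argument; the step function of a primitive recursion receives the
  previous counter, the previous value and the parameters, in this order.\<close>

inductive evaluates :: "recf \<Rightarrow> nat list \<Rightarrow> nat \<Rightarrow> bool" where
  "evaluates Zero xs 0"
| "evaluates Succ (x # xs) (Suc x)"
| "i < length xs \<Longrightarrow> evaluates (Proj i) xs (xs ! i)"
| "length ys = length gs \<Longrightarrow> (\<forall>i<length gs. evaluates (gs ! i) xs (ys ! i)) \<Longrightarrow>
     evaluates h ys y \<Longrightarrow> evaluates (Comp h gs) xs y"
| "evaluates g xs y \<Longrightarrow> evaluates (PrimRec g h) (0 # xs) y"
| "evaluates (PrimRec g h) (n # xs) z \<Longrightarrow> evaluates h (n # z # xs) y \<Longrightarrow>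
     evaluates (PrimRec g h) (Suc n # xs) y"
| "(\<forall>k<n. \<exists>y. 0 < y \<and> evaluates g (k # xs) y) \<Longrightarrow> evaluates g (n # xs) 0 \<Longrightarrow>
     evaluates (Mu g) xs n"

definition computable :: "(nat \<Rightarrow> nat) \<Rightarrow> bool" where
  "computable g \<longleftrightarrow> (\<exists>e. \<forall>x y. evaluates e [x] y \<longleftrightarrow> y = g x)"

definition comp_enumerable :: "nat set \<Rightarrow> bool" where
  "comp_enumerable A \<longleftrightarrow> (\<exists>e. A = {n. \<exists>y. evaluates e [n] y})"

section \<open>Enumeration operators\<close>

type_synonym axiom_set = "(nat \<times> nat set) set"

text \<open>The code of a pair \<open>(x, D)\<close> uses Cantor pairing and the canonical index of \<open>D\<close>. It is
  meaningful only for finite \<open>D\<close> (\<open>set_encode\<close> sends every infinite set to \<open>0\<close>).\<close>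

definition pair_code :: "nat \<times> nat set \<Rightarrow> nat" where
  "pair_code xD = prod_encode (fst xD, set_encode (snd xD))"

definition enumeration_operator :: "axiom_set \<Rightarrow> bool" where
  "enumeration_operator H \<longleftrightarrow>
     (\<forall>(x, D) \<in> H. finite D) \<and> comp_enumerable (pair_code ` H)"

definition app :: "axiom_set \<Rightarrow> nat set \<Rightarrow> nat set" where
  "app H X = {x. \<exists>D. finite D \<and> D \<subseteq> X \<and> (x, D) \<in> H}"

definition algebraic_closure_operator :: "axiom_set \<Rightarrow> bool" where
  "algebraic_closure_operator H \<longleftrightarrow>
     (\<forall>X. X \<subseteq> app H X) \<and> (\<forall>X. app H (app H X) \<subseteq> app H X)"

text \<open>A sequence of finite sets is computable when the sequence of their canonical indices is.\<close>

definition computable_approximation :: "axiom_set \<Rightarrow> (nat \<Rightarrow> axiom_set) \<Rightarrow> bool" where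
  "computable_approximation H \<alpha> \<longleftrightarrow>
     (\<forall>s. finite (\<alpha> s)) \<and> mono \<alpha> \<and> (\<Union>s. \<alpha> s) = H \<and>
     computable (\<lambda>s. set_encode (pair_code ` \<alpha> s))"

section \<open>p-dialectical systems\<close>

record p_system =
  Hop :: axiom_set
  perm :: "nat \<Rightarrow> nat"            (* f *)
  repl :: "nat \<Rightarrow> nat"            (* f^- *)
  contra :: nat                     (* c *)

definition acyclic_fun :: "(nat \<Rightarrow> nat) \<Rightarrow> bool" where
  "acyclic_fun g \<longleftrightarrow> (\<forall>x. infinite {(g ^^ n) x | n. True})"

definition p_dialectical_system :: "p_system \<Rightarrow> bool" where
  "p_dialectical_system p \<longleftrightarrow>
     enumeration_operator (Hop p) \<and> algebraic_closure_operator (Hop p) \<and>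
     app (Hop p) {} \<noteq> {} \<and> app (Hop p) {contra p} = UNIV \<and>
     computable (perm p) \<and> bij (perm p) \<and>
     computable (repl p) \<and> acyclic_fun (repl p)"

section \<open>The p-dialectical procedure\<close>

text \<open>Stacks are lists whose last element is the top.\<close>

definition tops :: "(nat \<Rightarrow> nat list) \<Rightarrow> nat \<Rightarrow> nat set" where
  "tops r x = {last (r y) | y. y < x \<and> r y \<noteq> []}"

fun procedure :: "p_system \<Rightarrow> (nat \<Rightarrow> axiom_set) \<Rightarrow> nat \<Rightarrow> nat \<times> (nat \<Rightarrow> nat list)" where
  "procedure p \<alpha> 0 = (0, \<lambda>x. if x = 0 then [perm p 0] else [])"
| "procedure p \<alpha> (Suc s) =
     (let m = fst (procedure p \<alpha> s);
          r = snd (procedure p \<alpha> s);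
          bad = (\<lambda>k. k \<le> m \<and> contra p \<in> app (\<alpha> s) (tops r (k + 1)))
      in if \<not> (\<exists>k. bad k)
         then (m + 1, \<lambda>x. if x \<le> m then r x
                          else if x = m + 1 then [perm p (m + 1)]
                          else [])
         else let z = (LEAST k. bad k)
              in (z, \<lambda>x. if x < z then r x
                         else if x = z then r z @ [repl p (last (r z))]
                         else []))"

definition m_at :: "p_system \<Rightarrow> (nat \<Rightarrow> axiom_set) \<Rightarrow> nat \<Rightarrow> nat" where
  "m_at p \<alpha> s = fst (procedure p \<alpha> s)"

definition r_at :: "p_system \<Rightarrow> (nat \<Rightarrow> axiom_set) \<Rightarrow> nat \<Rightarrow> nat \<Rightarrow> nat list" where
  "r_at p \<alpha> s x = snd (procedure p \<alpha> s) x"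

definition rho_at :: "p_system \<Rightarrow> (nat \<Rightarrow> axiom_set) \<Rightarrow> nat \<Rightarrow> nat \<Rightarrow> nat" where
  "rho_at p \<alpha> s x = last (r_at p \<alpha> s x)"

definition L_at :: "p_system \<Rightarrow> (nat \<Rightarrow> axiom_set) \<Rightarrow> nat \<Rightarrow> nat \<Rightarrow> nat set" where
  "L_at p \<alpha> s x = tops (r_at p \<alpha> s) x"

definition chi_at :: "p_system \<Rightarrow> (nat \<Rightarrow> axiom_set) \<Rightarrow> nat \<Rightarrow> nat \<Rightarrow> nat set" where
  "chi_at p \<alpha> s i = app (\<alpha> s) (L_at p \<alpha> s (i + 1))"

text \<open>At stage \<open>0\<close> the union is empty because \<open>m_at p \<alpha> 0 = 0\<close>.\<close>

definition A_at :: "p_system \<Rightarrow> (nat \<Rightarrow> axiom_set) \<Rightarrow> nat \<Rightarrow> nat set" where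
  "A_at p \<alpha> s = (\<Union>i<m_at p \<alpha> s. chi_at p \<alpha> s i)"

definition final_theses :: "p_system \<Rightarrow> (nat \<Rightarrow> axiom_set) \<Rightarrow> nat set" where
  "final_theses p \<alpha> = {perm p x | x. \<exists>t. \<forall>s\<ge>t. perm p x \<in> A_at p \<alpha> s}"

definition loopless_wrt :: "p_system \<Rightarrow> (nat \<Rightarrow> axiom_set) \<Rightarrow> bool" where
  "loopless_wrt p \<alpha> \<longleftrightarrow> computable_approximation (Hop p) \<alpha> \<and>
     (\<forall>u. finite {rho_at p \<alpha> s u | s. r_at p \<alpha> s u \<noteq> []})"

definition loopless :: "p_system \<Rightarrow> bool" where
  "loopless p \<longleftrightarrow> (\<exists>\<alpha>. loopless_wrt p \<alpha>)"

text \<open>The limit of a sequence of finite sets is taken in the discrete sense.\<close>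

definition limit_set :: "(nat \<Rightarrow> nat set) \<Rightarrow> nat set \<Rightarrow> bool" where
  "limit_set X Y \<longleftrightarrow> (\<exists>t. \<forall>s\<ge>t. X s = Y)"

end

theory Submission
  imports Defs
begin

text \<open>Every entry \<open>v\<close> that has been replaced in the stack at \<open>x\<close> makes \<open>L(x) \<union> {v}\<close>
  inconsistent. If the stacks below \<open>x\<close> have settled, the top of the stack at \<open>x\<close> is replaced
  exactly as long as an inconsistency with \<open>L(x)\<close> exists, since such an inconsistency
  is eventually enumerated. Hence the settled stacks are determined by \<open>H\<close> alone: looplessness with
  respect to one approximation yields settled stacks, and every other approximation settles on the
  same ones. The final theses are then the consequences of the union of all \<open>L(x)\<close>, which is
  consistent, and \<open>f\<^sub>x\<close> is among them iff it was never replaced or follows anyway.\<close>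

section \<open>Closure operators and orbits\<close>

lemma app_mono: "H \<subseteq> H' \<Longrightarrow> X \<subseteq> Y \<Longrightarrow> app H X \<subseteq> app H' Y"
  unfolding app_def by blast

lemma app_cut:
  assumes "algebraic_closure_operator H" "X \<subseteq> app H Y"
  shows "app H X \<subseteq> app H Y"
proof -
  have "app H X \<subseteq> app H (app H Y)"
    using assms(2) by (simp add: app_mono)
  also have "\<dots> \<subseteq> app H Y"
    using assms(1) unfolding algebraic_closure_operator_def by blast
  finally show ?thesis .
qed

text \<open>A repetition at indices \<open>i < j\<close> would let every iterate from
  \<open>j\<close> on be folded back to a smaller index, so the whole orbit would lie among its
  first \<open>j\<close> entries.\<close>

lemma acyclic_fun_inj_orbit:
  assumes "acyclic_fun g"
  shows "inj (\<lambda>n. (g ^^ n) x)"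
proof (rule linorder_injI)
  fix i j :: nat
  assume "i < j"
  show "(g ^^ i) x \<noteq> (g ^^ j) x"
  proof
    assume eq: "(g ^^ i) x = (g ^^ j) x"
    have "(g ^^ n) x \<in> (\<lambda>k. (g ^^ k) x) ` {..<j}" for n
    proof (induction n rule: less_induct)
      case (less n)
      show ?case
      proof (cases "n < j")
        case True
        then show ?thesis by blast
      next
        case False
        then have "(g ^^ n) x = (g ^^ (n - j)) ((g ^^ j) x)"
          using funpow_add[of "n - j" j g] by (simp add: fun_eq_iff)
        also have "\<dots> = (g ^^ (n - j + i)) x"
          unfolding eq[symmetric] by (simp add: funpow_add)
        finally show ?thesis
          using less.IH[of "n - j + i"] \<open>i < j\<close> False by simp
      qed
    qed
    then have "{(g ^^ n) x | n. True} \<subseteq> (\<lambda>k. (g ^^ k) x) ` {..<j}"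
      by blast
    then show False
      using assms finite_surj[of "{..<j}"] unfolding acyclic_fun_def by blast
  qed
qed

lemma bounded_incseq_eventually_const:
  fixes h :: "nat \<Rightarrow> nat"
  assumes "\<And>s. t \<le> s \<Longrightarrow> h s \<le> h (Suc s)" "\<And>s. t \<le> s \<Longrightarrow> h s \<le> b"
  obtains t' where "t \<le> t'" "\<And>s. t' \<le> s \<Longrightarrow> h s = h t'"
proof -
  have "finite (h ` {t..})"
    by (rule finite_subset[of _ "{..b}"]) (use assms(2) in auto)
  then have "Max (h ` {t..}) \<in> h ` {t..}" by (intro Max_in) auto
  then obtain t' where t': "t \<le> t'" "h t' = Max (h ` {t..})" by auto
  have "h s = h t'" if "t' \<le> s" for s
  proof (rule antisym)
    show "h s \<le> h t'"
      using t' \<open>finite (h ` {t..})\<close> that by simp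
    show "h t' \<le> h s"
      using that by (induction s rule: dec_induct)
        (use t'(1) assms(1) in \<open>auto intro: order_trans\<close>)
  qed
  with t'(1) show ?thesis using that by blast
qed

section \<open>Stacks\<close>

lemma tops_cong: "(\<And>y. y < x \<Longrightarrow> r y = r' y) \<Longrightarrow> tops r x = tops r' x"
  unfolding tops_def by (intro Collect_cong) metis

lemma tops_mono: "x \<le> y \<Longrightarrow> tops r x \<subseteq> tops r y"
  unfolding tops_def by (blast intro: less_le_trans)

lemma tops_Suc: "r x \<noteq> [] \<Longrightarrow> tops r (Suc x) = tops r x \<union> {last (r x)}"
  unfolding tops_def by (auto simp: less_Suc_eq)

text \<open>\<open>n\<close> is the number of replacements since the stack was last started with
  \<open>perm p x\<close>; it determines the stack and is one less than its length.\<close>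

definition stack :: "p_system \<Rightarrow> nat \<Rightarrow> nat \<Rightarrow> nat list" where
  "stack p x n = map (\<lambda>k. (repl p ^^ k) (perm p x)) [0..<Suc n]"

lemma stack_0: "stack p x 0 = [perm p x]"
  by (simp add: stack_def)

lemma stack_nonempty: "stack p x n \<noteq> []"
  by (simp add: stack_def)

lemma length_stack: "length (stack p x n) = Suc n"
  by (simp add: stack_def)

lemma last_stack: "last (stack p x n) = (repl p ^^ n) (perm p x)"
  by (simp add: stack_def)

lemma stack_Suc: "stack p x (Suc n) = stack p x n @ [repl p (last (stack p x n))]"
  by (simp add: stack_def)

text \<open>The invariant of a run. Inconsistency is measured by \<open>Hop p\<close> rather than by
  the current finite part, so that runs for different approximations can be compared. It concerns
  replaced entries only, hence \<open>k < n\<close>: the top is entry \<open>n\<close>.\<close>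

definition justified :: "p_system \<Rightarrow> (nat \<Rightarrow> nat list) \<Rightarrow> nat \<Rightarrow> nat \<Rightarrow> bool" where
  "justified p r x n \<longleftrightarrow> r x = stack p x n \<and>
     (\<forall>k<n. contra p \<in> app (Hop p) (tops r x \<union> {(repl p ^^ k) (perm p x)}))"

lemma justified_cong:
  "(\<And>y. y \<le> x \<Longrightarrow> r y = r' y) \<Longrightarrow> justified p r x n \<longleftrightarrow> justified p r' x n"
  unfolding justified_def using tops_cong[of x r r'] by simp

text \<open>No approximation occurs here: the height at \<open>x\<close> is the least
  \<open>n\<close> whose orbit entry is consistent with the tops below, so \<open>R\<close> is
  determined by recursion on \<open>x\<close>.\<close>

definition final_stacks :: "p_system \<Rightarrow> (nat \<Rightarrow> nat list) \<Rightarrow> bool" where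
  "final_stacks p R \<longleftrightarrow>
     (\<forall>x. (\<exists>n. justified p R x n) \<and> contra p \<notin> app (Hop p) (tops R (Suc x)))"

lemma final_stacks_consistent:
  assumes "final_stacks p R"
  shows "contra p \<notin> app (Hop p) (tops R x)"
  using assms app_mono[OF order_refl tops_mono[OF le_SucI[OF order_refl]]]
  unfolding final_stacks_def by blast

text \<open>If \<open>n' < n\<close>, the top of \<open>r'\<close> at \<open>x\<close> is an entry
  already replaced in \<open>r\<close>, hence inconsistent with the common tops below.\<close>

lemma justified_le:
  assumes "justified p r x n" "justified p r' x n'"
    and "tops r x = tops r' x" and "contra p \<notin> app (Hop p) (tops r' (Suc x))"
  shows "n \<le> n'"
proof (rule ccontr)
  assume "\<not> n \<le> n'"
  then have "contra p \<in> app (Hop p) (tops r x \<union> {(repl p ^^ n') (perm p x)})"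
    using assms(1) unfolding justified_def by auto
  moreover have "tops r' (Suc x) = tops r x \<union> {(repl p ^^ n') (perm p x)}"
    using assms(2,3) by (simp add: justified_def tops_Suc stack_nonempty last_stack)
  ultimately show False using assms(4) by simp
qed

section \<open>Runs of the procedure\<close>

locale procedure_run =
  fixes p :: p_system and \<alpha> :: "nat \<Rightarrow> axiom_set"
  assumes mono_approx: "mono \<alpha>" and Union_approx: "(\<Union>s. \<alpha> s) = Hop p"
begin

abbreviation "m \<equiv> m_at p \<alpha>"
abbreviation "r \<equiv> r_at p \<alpha>"

definition conflict :: "nat \<Rightarrow> nat \<Rightarrow> bool" where
  "conflict s k \<longleftrightarrow> k \<le> m s \<and> contra p \<in> app (\<alpha> s) (tops (r s) (Suc k))"

lemma approx_app: "app (\<alpha> s) X \<subseteq> app (Hop p) X"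
  using Union_approx by (intro app_mono) auto

text \<open>Membership rests on a single axiom, which stays once it has been enumerated.\<close>

lemma app_approx:
  assumes "v \<in> app (Hop p) X"
  obtains t where "\<And>s. t \<le> s \<Longrightarrow> v \<in> app (\<alpha> s) X"
proof -
  obtain D where D: "finite D" "D \<subseteq> X" "(v, D) \<in> Hop p"
    using assms unfolding app_def by blast
  then obtain t where "(v, D) \<in> \<alpha> t" using Union_approx by blast
  then have "(v, D) \<in> \<alpha> s" if "t \<le> s" for s
    using monoD[OF mono_approx that] by blast
  then show ?thesis using that D unfolding app_def by blast
qed

lemma m_0: "m 0 = 0" and r_0: "r 0 x = (if x = 0 then [perm p 0] else [])"
  by (simp_all add: m_at_def r_at_def)

lemma step_cases:
  obtains
    (extend) "\<And>k. \<not> conflict s k" "m (Suc s) = Suc (m s)"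
      "\<And>x. r (Suc s) x = (if x \<le> m s then r s x else if x = Suc (m s) then [perm p x] else [])"
  | (retract) z where "conflict s z" "\<And>k. k < z \<Longrightarrow> \<not> conflict s k" "m (Suc s) = z"
      "\<And>x. r (Suc s) x =
         (if x < z then r s x else if x = z then r s z @ [repl p (last (r s z))] else [])"
proof -
  have conflict: "conflict s = (\<lambda>k. k \<le> fst (procedure p \<alpha> s) \<and>
      contra p \<in> app (\<alpha> s) (tops (snd (procedure p \<alpha> s)) (k + 1)))"
    by (simp add: conflict_def[abs_def] m_at_def r_at_def[abs_def])
  show ?thesis
  proof (cases "\<exists>k. conflict s k")
    case False
    then have "procedure p \<alpha> (Suc s) = (m s + 1, \<lambda>x. if x \<le> m s then r s x
        else if x = m s + 1 then [perm p (m s + 1)] else [])"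
      unfolding conflict by (simp only: procedure.simps Let_def m_at_def r_at_def if_True simp_thms)
    with False show ?thesis by (intro extend) (simp_all add: m_at_def r_at_def)
  next
    case True
    define z where "z = (LEAST k. conflict s k)"
    have "conflict s z" and "\<And>k. k < z \<Longrightarrow> \<not> conflict s k"
      using LeastI_ex[OF True] not_less_Least unfolding z_def by blast+
    moreover have "procedure p \<alpha> (Suc s) = (z, \<lambda>x. if x < z then r s x
        else if x = z then r s z @ [repl p (last (r s z))] else [])"
      using True unfolding z_def conflict
      by (simp only: procedure.simps Let_def m_at_def r_at_def if_False simp_thms)
    ultimately show ?thesis by (intro retract[of z]) (simp_all add: m_at_def r_at_def)
  qed
qed

text \<open>A newly started stack has no replaced entries. When the top at \<open>z\<close> is
  replaced, the conflict at \<open>z\<close> is exactly the inconsistency of that top with the tops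
  below \<open>z\<close>, which do not change.\<close>

lemma stacks_justified:
  "(m s < x \<longrightarrow> r s x = []) \<and> (x \<le> m s \<longrightarrow> (\<exists>n. justified p (r s) x n))"
proof (induction s arbitrary: x)
  case 0
  show ?case by (auto simp: m_0 r_0 justified_def stack_0 intro!: exI[of _ 0])
next
  case (Suc s)
  show ?case
  proof (cases s rule: step_cases)
    case extend
    have "r (Suc s) y = r s y" if "y \<le> m s" for y
      using that by (simp add: extend(3))
    then have "\<exists>n. justified p (r (Suc s)) x n" if "x \<le> m s"
      using Suc[of x] that justified_cong[of x "r s" "r (Suc s)" p] by (metis order_trans)
    moreover have "justified p (r (Suc s)) x 0" if "x = Suc (m s)"
      using that by (simp add: justified_def extend(3) stack_0)
    moreover have "r (Suc s) x = []" if "m (Suc s) < x"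
      using that by (simp add: extend(2,3))
    ultimately show ?thesis unfolding extend(2) le_Suc_eq by blast
  next
    case (retract z)
    have z: "z \<le> m s" "contra p \<in> app (Hop p) (tops (r s) (Suc z))"
      using retract(1) approx_app unfolding conflict_def by blast+
    have below: "r (Suc s) y = r s y" if "y < z" for y
      using that by (simp add: retract(4))
    then have "\<exists>n. justified p (r (Suc s)) x n" if "x < z"
      using Suc[of x] that z(1) justified_cong[of x "r s" "r (Suc s)" p]
      by (metis le_less_trans less_imp_le_nat order_trans)
    moreover have "\<exists>n. justified p (r (Suc s)) z n"
    proof -
      obtain n where n: "justified p (r s) z n" using Suc[of z] z(1) by blast
      have "tops (r (Suc s)) z = tops (r s) z"
        using below by (rule tops_cong)
      moreover have "r (Suc s) z = stack p z (Suc n)"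
        using n by (simp add: justified_def retract(4) stack_Suc)
      ultimately have "justified p (r (Suc s)) z (Suc n)"
        using n z(2)
        by (auto simp: justified_def less_Suc_eq tops_Suc stack_nonempty last_stack)
      then show ?thesis by blast
    qed
    moreover have "r (Suc s) x = []" if "z < x"
      using that by (simp add: retract(4))
    ultimately show ?thesis unfolding retract(3) le_less by blast
  qed
qed

lemma stack_nonempty_iff: "r s x \<noteq> [] \<longleftrightarrow> x \<le> m s"
  using stacks_justified[where s = s and x = x] stack_nonempty unfolding justified_def
  by (metis not_le)

section \<open>Stacks that have settled\<close>

text \<open>Nonemptiness is included so that settled indices remain at most \<open>m s\<close>,
  where conflicts are tested.\<close>

definition settled :: "(nat \<Rightarrow> nat list) \<Rightarrow> nat \<Rightarrow> nat \<Rightarrow> bool" where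
  "settled R x t \<longleftrightarrow> (\<forall>s\<ge>t. \<forall>y<x. r s y = R y \<and> R y \<noteq> [])"

lemma settledD: "settled R x t \<Longrightarrow> t \<le> s \<Longrightarrow> y < x \<Longrightarrow> r s y = R y \<and> R y \<noteq> []"
  unfolding settled_def by blast

lemma settled_tops: "settled R x t \<Longrightarrow> t \<le> s \<Longrightarrow> y \<le> x \<Longrightarrow> tops (r s) y = tops R y"
  using settledD by (intro tops_cong) auto

lemma settled_m: "settled R (Suc x) t \<Longrightarrow> t \<le> s \<Longrightarrow> x \<le> m s"
  using settledD[of R "Suc x" t s x] stack_nonempty_iff[of s x] by simp

lemma settled_no_conflict:
  assumes "settled R x t" "t \<le> s" "k < x"
  shows "\<not> conflict s k"
proof (cases s rule: step_cases)
  case (retract z)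
  have "\<not> z < x"
  proof
    assume "z < x"
    \<comment> \<open>Stage \<open>Suc s\<close> also lies beyond \<open>t\<close>, yet retracting
      to \<open>z\<close> appends an entry there.\<close>
    then have "r (Suc s) z = r s z"
      using settledD[OF assms(1)] assms(2) by simp
    then show False by (simp add: retract(4))
  qed
  then show ?thesis using retract(2) assms(3) by simp
qed

text \<open>An inconsistency would eventually be enumerated and cause a conflict among the settled
  stacks.\<close>

lemma settled_consistent:
  assumes "settled R (Suc x) t"
  shows "contra p \<notin> app (Hop p) (tops R (Suc x))"
proof
  assume "contra p \<in> app (Hop p) (tops R (Suc x))"
  then obtain t' where "\<And>s. t' \<le> s \<Longrightarrow> contra p \<in> app (\<alpha> s) (tops R (Suc x))"
    using app_approx by blast
  then have "conflict (max t t') x"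
    using settled_m[OF assms, of "max t t'"] settled_tops[OF assms, of "max t t'"]
    by (simp add: conflict_def)
  then show False using settled_no_conflict[OF assms] by simp
qed

lemma settled_justified:
  assumes "settled R (Suc x) t"
  shows "\<exists>n. justified p R x n"
  using stacks_justified[where s = t and x = x] settled_m[OF assms order_refl] settledD[OF assms order_refl]
    justified_cong[of x "r t" R p] by (metis less_Suc_eq_le)

lemma settled_final_stacks:
  assumes "\<And>x. \<exists>t. settled R x t"
  shows "final_stacks p R"
  unfolding final_stacks_def using assms settled_consistent settled_justified by blast

lemma settled_eventually_nonempty:
  assumes "settled R x t"
  obtains t' where "t \<le> t'" "\<And>s. t' \<le> s \<Longrightarrow> x \<le> m s"
proof -
  have step: "x \<le> m (Suc s)" if "t \<le> s" "x \<le> Suc (m s)" for s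
    using settled_no_conflict[OF assms that(1)] that(2)
    by (cases s rule: step_cases) (auto simp: not_le[symmetric])
  \<comment> \<open>Settledness at \<open>t\<close> only yields that indices below \<open>x\<close>
    are active; the stage after \<open>t\<close> either extends or retracts to some \<open>z\<close>
    with \<open>x \<le> z\<close>, which activates \<open>x\<close>.\<close>
  have "x \<le> Suc (m t)"
    using settled_m[of R "x - 1" t t] assms by (cases x) auto
  have "x \<le> m s" if "Suc t \<le> s" for s
    using that
  proof (induction s rule: dec_induct)
    case base
    show ?case using step[OF order_refl \<open>x \<le> Suc (m t)\<close>] .
  next
    case (step s)
    then show ?case using \<open>\<And>s. t \<le> s \<Longrightarrow> x \<le> Suc (m s) \<Longrightarrow> x \<le> m (Suc s)\<close>[of s] by simp
  qed
  then show ?thesis using that[of "Suc t"] by auto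
qed

text \<open>Once the stacks below have settled and \<open>x\<close> stays active, the stack at
  \<open>x\<close> is never erased and can only grow, so a bound on its height forces it to settle.
  The bound is left open because it has two sources: looplessness, or comparison with known final
  stacks.\<close>

lemma settled_step:
  assumes "settled R x t" "\<And>s n. t \<le> s \<Longrightarrow> r s x = stack p x n \<Longrightarrow> n \<le> b"
  obtains R' t' where "settled R' (Suc x) t'" "\<And>y. y < x \<Longrightarrow> R' y = R y"
proof -
  obtain t0 where t0: "t \<le> t0" "\<And>s. t0 \<le> s \<Longrightarrow> x \<le> m s"
    using settled_eventually_nonempty[OF assms(1)] by blast
  have "\<exists>n. r s x = stack p x n" if "t0 \<le> s" for s
    using stacks_justified[where s = s and x = x] t0(2)[OF that] unfolding justified_def by blast
  then obtain n where n: "\<And>s. t0 \<le> s \<Longrightarrow> r s x = stack p x (n s)" by metis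
  have "n s \<le> n (Suc s)" if "t0 \<le> s" for s
  proof -
    have "length (r s x) \<le> length (r (Suc s) x)"
    proof (cases s rule: step_cases)
      case extend
      then show ?thesis using t0(2)[OF that] by simp
    next
      case (retract z)
      then have "\<not> z < x"
        using settled_no_conflict[OF assms(1)] t0(1) that by (meson order_trans)
      then show ?thesis by (auto simp: retract(4))
    qed
    then show ?thesis using n that by (simp add: length_stack)
  qed
  moreover have "n s \<le> b" if "t0 \<le> s" for s
    using assms(2)[OF order_trans[OF t0(1) that] n[OF that]] .
  ultimately obtain t1 where t1: "t0 \<le> t1" "\<And>s. t1 \<le> s \<Longrightarrow> n s = n t1"
    using bounded_incseq_eventually_const[of t0 n b] by blast
  have "settled (R(x := stack p x (n t1))) (Suc x) t1"
    unfolding settled_def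
  proof (intro allI impI)
    fix s y assume "t1 \<le> s" "y < Suc x"
    then show "r s y = (R(x := stack p x (n t1))) y \<and> (R(x := stack p x (n t1))) y \<noteq> []"
      using n[of s] t1(1) t1(2)[of s] settledD[OF assms(1), of s y] t0(1)
      by (auto simp: stack_nonempty less_Suc_eq)
  qed
  then show ?thesis using that by auto
qed

section \<open>Existence and uniqueness of the limit stacks\<close>

text \<open>Distinct heights have distinct tops, since orbits of an acyclic function are
  injective.\<close>

lemma finite_tops_imp_bounded:
  assumes "acyclic_fun (repl p)" "finite {rho_at p \<alpha> s x | s. r s x \<noteq> []}"
  shows "\<exists>b. \<forall>s n. r s x = stack p x n \<longrightarrow> n \<le> b"
proof -
  let ?N = "{n. \<exists>s. r s x = stack p x n}"
  have "(\<lambda>n. (repl p ^^ n) (perm p x)) ` ?N \<subseteq> {rho_at p \<alpha> s x | s. r s x \<noteq> []}"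
    by (auto simp: rho_at_def) (metis last_stack stack_nonempty)
  then have "finite ?N"
    using assms(2) acyclic_fun_inj_orbit[OF assms(1)]
    by (meson finite_imageD finite_subset inj_on_subset subset_UNIV)
  then show ?thesis unfolding finite_nat_set_iff_bounded_le by blast
qed

lemma loopless_settled:
  assumes "acyclic_fun (repl p)" "\<And>x. finite {rho_at p \<alpha> s x | s. r s x \<noteq> []}"
  obtains R where "\<And>x. \<exists>t. settled R x t"
proof -
  have ex: "\<exists>R t. settled R x t" for x
  proof (induction x)
    case 0
    show ?case by (auto simp: settled_def)
  next
    case (Suc x)
    then obtain R t where R: "settled R x t" by blast
    obtain b where b: "\<And>s n. r s x = stack p x n \<Longrightarrow> n \<le> b"
      using finite_tops_imp_bounded[OF assms] by blast
    obtain R' t' where "settled R' (Suc x) t'" by (rule settled_step[OF R b])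
    then show ?case by blast
  qed
  have "\<forall>x. \<exists>R t. settled R (Suc x) t" using ex by simp
  then obtain R T where RT: "\<And>x. settled (R x) (Suc x) (T x)" unfolding choice_iff by blast
  \<comment> \<open>The induction gives a separate limit for each initial segment; the diagonal
    glues them. The sum is just a common upper bound of the settling times.\<close>
  have "settled (\<lambda>y. R y y) x (\<Sum>y<x. T y)" for x
    unfolding settled_def
  proof (intro allI impI)
    fix s y assume "(\<Sum>y<x. T y) \<le> s" "y < x"
    moreover have "T y \<le> (\<Sum>y<x. T y)"
      using \<open>y < x\<close> by (intro member_le_sum) auto
    ultimately show "r s y = R y y \<and> R y y \<noteq> []"
      using settledD[OF RT[of y], of s y] by simp
  qed
  then show ?thesis using that by blast
qed

text \<open>This transfers the limit found for one approximation to the run of another, with no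
  looplessness assumed for the latter.\<close>

lemma final_stacks_settled:
  assumes "final_stacks p R"
  shows "\<exists>t. settled R x t"
proof (induction x)
  case 0
  show ?case by (auto simp: settled_def)
next
  case (Suc x)
  then obtain t where t: "settled R x t" by blast
  obtain N where N: "justified p R x N" and cons: "contra p \<notin> app (Hop p) (tops R (Suc x))"
    using assms unfolding final_stacks_def by blast
  \<comment> \<open>Entry \<open>N\<close> is consistent with the settled tops below, so a justified
    stack cannot have replaced it.\<close>
  have "n \<le> N" if "t \<le> s" "r s x = stack p x n" for s n
  proof -
    have "x \<le> m s" using that(2) stack_nonempty stack_nonempty_iff by metis
    then obtain n' where n': "justified p (r s) x n'"
      using stacks_justified[where s = s and x = x] by blast
    then have "stack p x n = stack p x n'" using that(2) unfolding justified_def by simp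
    then have "n' = n" by (metis length_stack nat.inject)
    then show ?thesis
      using justified_le[OF n' N settled_tops[OF t that(1) order_refl] cons] by simp
  qed
  then obtain R' t' where R': "settled R' (Suc x) t'" and eq: "\<And>y. y < x \<Longrightarrow> R' y = R y"
    using settled_step[OF t, of N] by blast
  obtain n where n: "justified p R' x n" using settled_justified[OF R'] by blast
  have tops_eq: "tops R' x = tops R x" using eq by (rule tops_cong)
  \<comment> \<open>One inequality uses consistency of \<open>R\<close>, the other that of the
    settled \<open>R'\<close>.\<close>
  have "n = N"
    using justified_le[OF n N tops_eq cons]
      justified_le[OF N n tops_eq[symmetric] settled_consistent[OF R']] by simp
  then have "R' x = R x" using n N unfolding justified_def by simp
  then have "settled R (Suc x) t'"
    using R' eq unfolding settled_def by (metis less_Suc_eq)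
  then show ?case by blast
qed

section \<open>Final theses as consequences of the limit stacks\<close>

lemma minimal_stage_stacks:
  assumes "\<And>s'. s \<le> s' \<Longrightarrow> m s \<le> m s'" "y < m s" "s \<le> s'"
  shows "r s' y = r s y"
  using assms(3)
proof (induction s' rule: dec_induct)
  case (step s')
  have "y < m s'" "y < m (Suc s')"
    using assms(1)[of s'] assms(1)[of "Suc s'"] assms(2) step.hyps(1) by linarith+
  then have "r (Suc s') y = r s' y" by (cases s' rule: step_cases) auto
  with step.IH show ?case by simp
qed simp

text \<open>The index that puts \<open>v\<close> into \<open>A_at p \<alpha> s\<close> may vary with
  \<open>s\<close>. At a stage where \<open>m\<close> is least from \<open>t\<close> on, all stacks
  below \<open>m s\<close> are already final, so that one stage suffices.\<close>

lemma final_theses_imp_closure: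
  assumes "\<And>x. \<exists>t. settled R x t" "\<And>s. t \<le> s \<Longrightarrow> v \<in> A_at p \<alpha> s"
  shows "\<exists>y. v \<in> app (Hop p) (tops R y)"
proof -
  obtain s where s: "t \<le> s" "\<And>s'. t \<le> s' \<Longrightarrow> m s \<le> m s'"
    using ex_has_least_nat[of "\<lambda>s. t \<le> s" t m] by auto
  obtain t' where t': "settled R (m s) t'" using assms(1) by blast
  have "r s y = R y" if "y < m s" for y
    using minimal_stage_stacks[of s y "max s t'"] settledD[OF t', of "max s t'" y] s that
    by simp
  then have "tops (r s) (m s) = tops R (m s)" by (rule tops_cong)
  \<comment> \<open>As \<open>i < m s\<close>, only stacks strictly below \<open>m s\<close> are
    used; the possibly unsettled one at \<open>m s\<close> is not.\<close>
  moreover obtain i where "i < m s" "v \<in> app (\<alpha> s) (tops (r s) (Suc i))"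
    using assms(2)[OF s(1)] unfolding A_at_def chi_at_def L_at_def by auto
  ultimately have "v \<in> app (Hop p) (tops R (m s))"
    using approx_app app_mono[OF order_refl tops_mono[of "Suc i" "m s" "r s"]]
    by (metis Suc_leI subsetD)
  then show ?thesis by blast
qed

lemma closure_imp_final_theses:
  assumes "\<And>x. \<exists>t. settled R x t" "v \<in> app (Hop p) (tops R (Suc x))"
  shows "\<exists>t. \<forall>s\<ge>t. v \<in> A_at p \<alpha> s"
proof -
  \<comment> \<open>The second \<open>Suc\<close> makes \<open>x < m s\<close> strict, as the union
    in \<open>A_at\<close> requires.\<close>
  obtain t where t: "settled R (Suc (Suc x)) t" using assms(1) by blast
  obtain t' where t': "\<And>s. t' \<le> s \<Longrightarrow> v \<in> app (\<alpha> s) (tops R (Suc x))"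
    using app_approx[OF assms(2)] by blast
  have "v \<in> A_at p \<alpha> s" if "max t t' \<le> s" for s
  proof -
    have "x < m s" using settled_m[OF t, of s] that by simp
    moreover have "v \<in> chi_at p \<alpha> s x"
      using t'[of s] settled_tops[OF t, of s "Suc x"] that by (simp add: chi_at_def L_at_def)
    ultimately show ?thesis unfolding A_at_def by blast
  qed
  then show ?thesis by blast
qed

lemma final_theses_iff:
  assumes "algebraic_closure_operator (Hop p)" "inj (perm p)" "final_stacks p R"
  shows "perm p x \<in> final_theses p \<alpha> \<longleftrightarrow>
    contra p \<notin> app (Hop p) (tops R x \<union> {perm p x})"
proof -
  have settled: "\<exists>t. settled R y t" for y
    using final_stacks_settled[OF assms(3)] .
  have ext: "X \<subseteq> app (Hop p) X" for X
    using assms(1) unfolding algebraic_closure_operator_def by blast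
  have "perm p x \<in> final_theses p \<alpha> \<longleftrightarrow> (\<exists>t. \<forall>s\<ge>t. perm p x \<in> A_at p \<alpha> s)"
    using injD[OF assms(2)] unfolding final_theses_def by auto
  also have "\<dots> \<longleftrightarrow> contra p \<notin> app (Hop p) (tops R x \<union> {perm p x})"
  proof
    assume "\<exists>t. \<forall>s\<ge>t. perm p x \<in> A_at p \<alpha> s"
    then obtain y where y: "perm p x \<in> app (Hop p) (tops R y)"
      using final_theses_imp_closure[OF settled] by blast
    \<comment> \<open>A single consistent set that contains \<open>tops R x\<close> and has
      \<open>perm p x\<close> as a consequence.\<close>
    let ?T = "tops R (max x y)"
    have "perm p x \<in> app (Hop p) ?T"
      using y app_mono[OF order_refl tops_mono[of y "max x y" R]] by auto
    moreover have "tops R x \<subseteq> app (Hop p) ?T"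
      using ext tops_mono[of x "max x y" R] by force
    ultimately have "app (Hop p) (tops R x \<union> {perm p x}) \<subseteq> app (Hop p) ?T"
      by (intro app_cut[OF assms(1)]) simp
    then show "contra p \<notin> app (Hop p) (tops R x \<union> {perm p x})"
      using final_stacks_consistent[OF assms(3)] by blast
  next
    assume *: "contra p \<notin> app (Hop p) (tops R x \<union> {perm p x})"
    obtain n where n: "justified p R x n" using assms(3) unfolding final_stacks_def by blast
    \<comment> \<open>Entry \<open>0\<close> is \<open>perm p x\<close> itself; had it been
      replaced, \<open>justified\<close> at \<open>k = 0\<close> would contradict the assumed
      consistency.\<close>
    have "n = 0" using * n unfolding justified_def by (metis funpow_0 gr0I)
    then have "perm p x \<in> tops R (Suc x)"
      using n by (simp add: justified_def tops_Suc stack_0)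
    then show "\<exists>t. \<forall>s\<ge>t. perm p x \<in> A_at p \<alpha> s"
      using closure_imp_final_theses[OF settled] ext by blast
  qed
  finally show ?thesis .
qed

end

theorem theorem1p10:
  fixes p :: p_system
  assumes "p_dialectical_system p"
    and "loopless p"
  shows "\<forall>\<alpha>. loopless_wrt p \<alpha> \<longrightarrow>
    (\<exists>L. (\<forall>x. limit_set (\<lambda>s. L_at p \<alpha> s x) (L x)) \<and>
         (\<forall>\<beta>. computable_approximation (Hop p) \<beta> \<longrightarrow>
            (\<forall>x. perm p x \<in> final_theses p \<beta> \<longleftrightarrow>
                 contra p \<notin> app (Hop p) (L x \<union> {perm p x}))))"
proof (intro allI impI)
  fix \<alpha>
  assume \<alpha>: "loopless_wrt p \<alpha>"
  have p: "algebraic_closure_operator (Hop p)" "inj (perm p)" "acyclic_fun (repl p)"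
    using assms(1) unfolding p_dialectical_system_def by (simp_all add: bij_is_inj)
  have run: "procedure_run p \<beta>" if "computable_approximation (Hop p) \<beta>" for \<beta>
    using that unfolding computable_approximation_def procedure_run_def by blast
  interpret procedure_run p \<alpha>
    using run \<alpha> unfolding loopless_wrt_def by blast
  obtain R where R: "\<And>x. \<exists>t. settled R x t"
    using loopless_settled[OF p(3)] \<alpha> unfolding loopless_wrt_def by blast
  have "limit_set (\<lambda>s. L_at p \<alpha> s x) (tops R x)" for x
    using R[of x] settled_tops unfolding limit_set_def L_at_def by blast
  moreover have "perm p x \<in> final_theses p \<beta> \<longleftrightarrow>
      contra p \<notin> app (Hop p) (tops R x \<union> {perm p x})"
    if "computable_approximation (Hop p) \<beta>" for \<beta> x
    \<comment> \<open>\<open>final_stacks p R\<close> comes from the run of \<open>\<alpha>\<close>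
      but mentions no approximation, so it applies to the run of \<open>\<beta>\<close>.\<close>
    using procedure_run.final_theses_iff[OF run[OF that] p(1,2) settled_final_stacks[OF R]] .
  ultimately show "\<exists>L. (\<forall>x. limit_set (\<lambda>s. L_at p \<alpha> s x) (L x)) \<and>
         (\<forall>\<beta>. computable_approximation (Hop p) \<beta> \<longrightarrow>
            (\<forall>x. perm p x \<in> final_theses p \<beta> \<longleftrightarrow>
                 contra p \<notin> app (Hop p) (L x \<union> {perm p x})))"
    by (intro exI[of _ "tops R"]) blast
qed

end
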